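(* Let $Y^T,Y^C$ be real random variables with finite second moments, $D\in\{0,1\}$ a random variable, and let $X=(I,U,C)$ be a random vector of covariates. Assume: (i) (unconfoundedness) $(Y^T,Y^C)\perp D\mid X$; (ii) (overlap) $0<p(X)<1$ almost surely, where $p(X)=\mathbf{P}(D=1\mid X)$; (iii) $(Y^T,Y^C)\perp I\mid (U,C)$. Let $X_1=(U,C)$ and $\beta=\mathbf{E}Y^T-\mathbf{E}Y^C$. Then the semi-parametric efficiency bound for estimating $\beta$ becomes larger (weakly) after including $I$ in the covariates, i.e. $$\mathbf{E}\left[\frac{\sigma_T^2(X_1)}{p(X_1)}+\frac{\sigma_C^2(X_1)}{1-p(X_1)}+(\beta(X_1)-\beta)^2\right]\ \le\ \mathbf{E}\left[\frac{\sigma_T^2(X)}{p(X)}+\frac{\sigma_C^2(X)}{1-p(X)}+(\beta(X)-\beta)^2\right].$$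
   Context: Notation: $\perp$ denotes (conditional) independence. For a random vector $Z$ of covariates ($Z=X$ or $Z=X_1$): $p(Z)=\mathbf{P}(D=1\mid Z)$, $\beta_T(Z)=\mathbf{E}[Y^T\mid Z]$, $\beta_C(Z)=\mathbf{E}[Y^C\mid Z]$, $\beta(Z)=\beta_T(Z)-\beta_C(Z)$, $\sigma_T^2(Z)=\mathbf{var}(Y^T\mid Z)$, $\sigma_C^2(Z)=\mathbf{var}(Y^C\mid Z)$. The semi-parametric efficiency bound for $\beta$ with covariates $Z$ is by definition here the quantity $\mathbf{E}[\sigma_T^2(Z)/p(Z)+\sigma_C^2(Z)/(1-p(Z))+(\beta(Z)-\beta)^2]$. Expectations of nonnegative quantities are allowed to take values in $[0,\infty]$. *)

theory Defs
  imports "HOL-Probability.Probability"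
begin

(* Conditioning on a random vector Z means conditioning on the sigma-algebra generated by Z.
   The results are random variables on M; real_cond_exp fixes one version, and all uses below
   depend on it only up to null sets. *)

definition sigma_of :: "'a measure \<Rightarrow> ('a \<Rightarrow> 'z::topological_space) \<Rightarrow> 'a measure" where
  "sigma_of M Z = vimage_algebra (space M) Z borel"

definition cexp :: "'a measure \<Rightarrow> ('a \<Rightarrow> 'z::topological_space) \<Rightarrow> ('a \<Rightarrow> real) \<Rightarrow> 'a \<Rightarrow> real" where
  "cexp M Z Y = real_cond_exp M (sigma_of M Z) Y"

definition cprob :: "'a measure \<Rightarrow> ('a \<Rightarrow> 'z::topological_space) \<Rightarrow> ('a \<Rightarrow> bool) \<Rightarrow> 'a \<Rightarrow> real" where
  "cprob M Z P = cexp M Z (indicator {\<omega> \<in> space M. P \<omega>})"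

definition cvar :: "'a measure \<Rightarrow> ('a \<Rightarrow> 'z::topological_space) \<Rightarrow> ('a \<Rightarrow> real) \<Rightarrow> 'a \<Rightarrow> real" where
  "cvar M Z Y = cexp M Z (\<lambda>\<omega>. (Y \<omega> - cexp M Z Y \<omega>)\<^sup>2)"

definition cond_indep ::
  "'a measure \<Rightarrow> ('a \<Rightarrow> 'v::topological_space) \<Rightarrow> ('a \<Rightarrow> 'w::topological_space)
    \<Rightarrow> ('a \<Rightarrow> 'z::topological_space) \<Rightarrow> bool" where
  "cond_indep M V W Z \<longleftrightarrow>
    (\<forall>A\<in>sets borel. \<forall>B\<in>sets borel. AE \<omega> in M.
      cprob M Z (\<lambda>\<omega>. V \<omega> \<in> A \<and> W \<omega> \<in> B) \<omega>
        = cprob M Z (\<lambda>\<omega>. V \<omega> \<in> A) \<omega> * cprob M Z (\<lambda>\<omega>. W \<omega> \<in> B) \<omega>)"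

definition propensity :: "'a measure \<Rightarrow> ('a \<Rightarrow> real) \<Rightarrow> ('a \<Rightarrow> 'z::topological_space) \<Rightarrow> 'a \<Rightarrow> real" where
  "propensity M D Z = cprob M Z (\<lambda>\<omega>. D \<omega> = 1)"

definition ate :: "'a measure \<Rightarrow> ('a \<Rightarrow> real) \<Rightarrow> ('a \<Rightarrow> real) \<Rightarrow> real" where
  "ate M YT YC = integral\<^sup>L M YT - integral\<^sup>L M YC"

definition cate :: "'a measure \<Rightarrow> ('a \<Rightarrow> real) \<Rightarrow> ('a \<Rightarrow> real) \<Rightarrow> ('a \<Rightarrow> 'z::topological_space)
    \<Rightarrow> 'a \<Rightarrow> real" where
  "cate M YT YC Z \<omega> = cexp M Z YT \<omega> - cexp M Z YC \<omega>"

(* The expectation is taken in [0,\<infinity>], since it need not be finite.  The embedding ennreal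
   truncates negative reals to 0; this matters only on null sets, because conditional variances
   are nonnegative and propensities lie in [0,1] almost surely. *)

definition efficiency_bound ::
  "'a measure \<Rightarrow> ('a \<Rightarrow> real) \<Rightarrow> ('a \<Rightarrow> real) \<Rightarrow> ('a \<Rightarrow> real) \<Rightarrow> ('a \<Rightarrow> 'z::topological_space)
    \<Rightarrow> ennreal" where
  "efficiency_bound M YT YC D Z =
    (\<integral>\<^sup>+ \<omega>. ennreal (cvar M Z YT \<omega>) / ennreal (propensity M D Z \<omega>)
        + ennreal (cvar M Z YC \<omega>) / ennreal (1 - propensity M D Z \<omega>)
        + ennreal ((cate M YT YC Z \<omega> - ate M YT YC)\<^sup>2) \<partial>M)"

(* real_cond_exp is meaningful only on sigma-finite subalgebras. *)
lemma (in prob_space) finite_measure_subalgebra_sigma_of: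
  assumes "Z \<in> borel_measurable M"
  shows "finite_measure_subalgebra M (sigma_of M Z)"
  using assms
  by unfold_locales (auto simp: subalgebra_def sigma_of_def sets_vimage_algebra2 measurable_sets)

end

theory Submission
  imports Defs
begin

text \<open>
  Exclusion says that \<open>I\<close> carries no information on \<open>(Y\<^sup>T, Y\<^sup>C)\<close> beyond \<open>(U, C)\<close>, so the conditional
  means and variances given \<open>X\<close> and given \<open>X\<^sub>1\<close> agree almost surely, and the two bounds differ only in
  the propensities.  These satisfy \<open>p(X\<^sub>1) = E[p(X) | X\<^sub>1]\<close>, so convexity of \<open>1/x\<close> gives
  \<open>1/p(X\<^sub>1) \<le> E[1/p(X) | X\<^sub>1]\<close>, and likewise for \<open>1 - p\<close>; weighting by the \<open>X\<^sub>1\<close>-measurable conditional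
  variances and integrating proves the claim.
\<close>

section \<open>Integral identities for conditional expectations\<close>

text \<open>Dynkin's argument: the sets on which the two integrals agree are closed under
  complement, by \<open>total\<close>, and under countable disjoint unions, by integrability. It
  reduces checking a conditional expectation to a \<pi>-system of generators, here the
  rectangles.\<close>

lemma set_integral_eq_on_sigma_sets:
  fixes f g :: "'a \<Rightarrow> real"
  assumes f: "integrable M f" and g: "integrable M g"
    and stable: "Int_stable E" and E: "E \<subseteq> sets M"
    and total: "(\<integral>x. f x \<partial>M) = (\<integral>x. g x \<partial>M)"
    and eq: "\<And>A. A \<in> E \<Longrightarrow> (\<integral>x\<in>A. f x \<partial>M) = (\<integral>x\<in>A. g x \<partial>M)"
    and A: "A \<in> sigma_sets (space M) E"
  shows "(\<integral>x\<in>A. f x \<partial>M) = (\<integral>x\<in>A. g x \<partial>M)"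
proof -
  have sets: "B \<in> sets M" if "B \<in> sigma_sets (space M) E" for B
    using that E sets.sigma_sets_subset by blast
  have setint: "set_integrable M B f" "set_integrable M B g" if "B \<in> sets M" for B
    using that f g integrable_mult_indicator unfolding set_integrable_def by blast+
  \<comment> \<open>Stated for an arbitrary integrable \<open>h\<close>, so that the complement case
    can apply it to both \<open>f\<close> and \<open>g\<close>.\<close>
  have space_diff: "(\<integral>x\<in>space M - B. h x \<partial>M) = (\<integral>x. h x \<partial>M) - (\<integral>x\<in>B. h x \<partial>M)"
    if "B \<in> sets M" "integrable M h" for B and h :: "'a \<Rightarrow> real"
  proof -
    have "(\<integral>x\<in>space M - B. h x \<partial>M) = (\<integral>x. h x - indicator B x *\<^sub>R h x \<partial>M)"
      unfolding set_lebesgue_integral_def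
      by (intro Bochner_Integration.integral_cong) (auto simp: indicator_def)
    also have "\<dots> = (\<integral>x. h x \<partial>M) - (\<integral>x\<in>B. h x \<partial>M)"
      unfolding set_lebesgue_integral_def
      using that integrable_mult_indicator by (intro Bochner_Integration.integral_diff) blast+
    finally show ?thesis .
  qed
  have "E \<subseteq> Pow (space M)"
    using E sets.sets_into_space by blast
  from stable this A show ?thesis
  proof (induction A rule: sigma_sets_induct_disjoint)
    case (union B)
    have disj: "B i \<inter> B j = {}" if "i \<noteq> j" for i j
      using union(1) that by (auto simp: disjoint_family_on_def)
    have B: "B i \<in> sets M" for i
      using union(2) sets by blast
    show ?case
      using lebesgue_integral_countable_add[of B M f] lebesgue_integral_countable_add[of B M g]
        disj B setint union(3) by (simp add: sets.countable_UN)
  next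
    case (basic B)
    then show ?case by (rule eq)
  next
    case (compl B)
    then show ?case by (simp add: space_diff sets f g total)
  qed (simp add: set_lebesgue_integral_def)
qed

lemma (in finite_measure_subalgebra) integrable_real_cond_exp_indicator:
  assumes "A \<in> sets M"
  shows "integrable M (real_cond_exp M F (indicator A))"
    "integrable M (indicat_real A)"
    "AE x in M. 0 \<le> real_cond_exp M F (indicator A) x"
    "AE x in M. real_cond_exp M F (indicator A) x \<le> 1"
proof -
  show int: "integrable M (indicat_real A)"
    using assms by (simp add: integrable_indicator_iff emeasure_eq_measure)
  then show "integrable M (real_cond_exp M F (indicator A))"
    by (rule real_cond_exp_int)
  show "AE x in M. 0 \<le> real_cond_exp M F (indicator A) x"
    using assms by (intro real_cond_exp_pos) auto
  show "AE x in M. real_cond_exp M F (indicator A) x \<le> 1"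
    using int by (intro real_cond_exp_le_c) (auto simp: indicator_def)
qed

text \<open>Self-adjointness of conditioning: both sides equal the integral of
  \<open>E[1_A | F] * E[f | F]\<close>. The products are integrable because
  \<open>E[1_A | F]\<close> lies in [0,1] almost surely.\<close>

lemma (in finite_measure_subalgebra) integral_indicator_mult_real_cond_exp:
  fixes f :: "'a \<Rightarrow> real"
  assumes A[measurable]: "A \<in> sets M" and f: "integrable M f"
  shows "(\<integral>x. real_cond_exp M F (indicator A) x * f x \<partial>M)
       = (\<integral>x. indicator A x * real_cond_exp M F f x \<partial>M)"
    and "integrable M (\<lambda>x. real_cond_exp M F (indicator A) x * f x)"
proof -
  note r = integrable_real_cond_exp_indicator[OF A]
  have [measurable]: "real_cond_exp M F (indicator A) \<in> borel_measurable M" "f \<in> borel_measurable M"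
    using f by auto
  show int: "integrable M (\<lambda>x. real_cond_exp M F (indicator A) x * f x)"
    using r(3,4)
    by (intro Bochner_Integration.integrable_bound[OF f])
       (auto elim!: eventually_elim2 simp: abs_mult intro!: mult_left_le_one_le)
  have int': "integrable M (\<lambda>x. real_cond_exp M F f x * indicat_real A x)"
    using integrable_mult_indicator[OF A real_cond_exp_int(1)[OF f]] by (simp add: mult.commute)
  have "(\<integral>x. real_cond_exp M F (indicator A) x * f x \<partial>M)
      = (\<integral>x. real_cond_exp M F (indicator A) x * real_cond_exp M F f x \<partial>M)"
    using real_cond_exp_intg(2)[OF int] by simp
  also have "\<dots> = (\<integral>x. real_cond_exp M F f x * indicator A x \<partial>M)"
    using real_cond_exp_intg(2)[OF int'] by (simp add: mult.commute)
  finally show "(\<integral>x. real_cond_exp M F (indicator A) x * f x \<partial>M)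
       = (\<integral>x. indicator A x * real_cond_exp M F f x \<partial>M)"
    by (simp add: mult.commute)
qed

text \<open>
  For \<open>S \<in> G\<close>, the hypothesis on indicators says that \<open>V\<close> has the same law under the densities \<open>1\<^sub>S\<close>
  and \<open>E[1\<^sub>S | H]\<close>; integrating \<open>h\<close> against this law gives the claim.
\<close>

lemma (in finite_measure) real_cond_exp_eq_of_indicators:
  fixes h :: "'v::topological_space \<Rightarrow> real"
  assumes G: "subalgebra M G" and H: "subalgebra M H" and HG: "subalgebra G H"
    and V[measurable]: "V \<in> borel_measurable M" and h[measurable]: "h \<in> borel_measurable borel"
    and int: "integrable M (\<lambda>x. h (V x))"
    and ind: "\<And>A. A \<in> sets borel \<Longrightarrow> AE x in M.
      real_cond_exp M G (indicator {x \<in> space M. V x \<in> A}) x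
        = real_cond_exp M H (indicator {x \<in> space M. V x \<in> A}) x"
  shows "AE x in M. real_cond_exp M G (\<lambda>x. h (V x)) x = real_cond_exp M H (\<lambda>x. h (V x)) x"
proof -
  interpret G: finite_measure_subalgebra M G by unfold_locales (rule G)
  interpret H: finite_measure_subalgebra M H by unfold_locales (rule H)
  have "(\<integral>x\<in>S. h (V x) \<partial>M) = (\<integral>x\<in>S. real_cond_exp M H (\<lambda>x. h (V x)) x \<partial>M)"
    if SG[measurable]: "S \<in> sets G" for S
  proof -
    have S[measurable]: "S \<in> sets M"
      using SG G by (auto simp: subalgebra_def)
    define r where "r = real_cond_exp M H (indicator S)"
    have r[measurable]: "r \<in> borel_measurable M" and r0: "AE x in M. 0 \<le> r x"
      using H.integrable_real_cond_exp_indicator[OF S] by (auto simp: r_def)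
    have "distr (density M (indicat_real S)) borel V = distr (density M r) borel V"
    proof (rule measure_eqI)
      fix A assume "A \<in> sets (distr (density M (indicat_real S)) borel V)"
      then have A[measurable]: "A \<in> sets borel" by simp
      define T where "T = {x \<in> space M. V x \<in> A}"
      have T[measurable]: "T \<in> sets M" by (simp add: T_def)
      have Tint: "integrable M (indicat_real T)"
        by (rule H.integrable_real_cond_exp_indicator[OF T])
      \<comment> \<open>Serves both densities, \<open>indicat_real S\<close> and \<open>r\<close>.
        Densities are coerced to \<open>ennreal\<close>, so nonnegativity of \<open>q\<close> is
        what turns the mass into a real integral.\<close>
      have em: "emeasure (distr (density M q) borel V) A = ennreal (\<integral>x. q x * indicator T x \<partial>M)"
        if [measurable]: "q \<in> borel_measurable M" and "AE x in M. 0 \<le> q x"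
          and "integrable M (\<lambda>x. q x * indicat_real T x)" for q :: "'a \<Rightarrow> real"
      proof -
        have TV: "V -` A \<inter> space M = T" by (auto simp: T_def)
        have "emeasure (distr (density M q) borel V) A = (\<integral>\<^sup>+x. ennreal (q x) * indicator T x \<partial>M)"
          by (simp add: emeasure_distr TV emeasure_density)
        also have "\<dots> = (\<integral>\<^sup>+x. ennreal (q x * indicator T x) \<partial>M)"
          by (intro nn_integral_cong) (auto simp: indicator_def)
        also have "\<dots> = ennreal (\<integral>x. q x * indicator T x \<partial>M)"
          using that by (intro nn_integral_eq_integral) (auto simp: indicator_def)
        finally show ?thesis .
      qed
      have int1: "integrable M (\<lambda>x. indicat_real S x * indicat_real T x)"
        using integrable_mult_indicator[OF S Tint] by simp
      \<comment> \<open>Since \<open>S\<close> is in \<open>G\<close>, conditioning on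
        \<open>G\<close> may be applied to \<open>1_T\<close>; the hypothesis on indicators replaces
        \<open>G\<close> by \<open>H\<close>; self-adjointness then moves the conditioning on
        \<open>H\<close> from \<open>1_T\<close> to \<open>1_S\<close>, producing
        \<open>r\<close>.\<close>
      have "(\<integral>x. indicat_real S x * indicator T x \<partial>M)
          = (\<integral>x. indicat_real S x * real_cond_exp M G (indicator T) x \<partial>M)"
        using G.real_cond_exp_intg(2)[OF int1] by simp
      also have "\<dots> = (\<integral>x. indicat_real S x * real_cond_exp M H (indicator T) x \<partial>M)"
        using ind[OF A] measurable_from_subalg[OF G borel_measurable_cond_exp]
          measurable_from_subalg[OF H borel_measurable_cond_exp]
        by (intro integral_cong_AE) (auto simp: T_def elim!: eventually_mono)
      also have "\<dots> = (\<integral>x. r x * indicator T x \<partial>M)"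
        using H.integral_indicator_mult_real_cond_exp(1)[OF S Tint] by (simp add: r_def)
      finally show "emeasure (distr (density M (indicat_real S)) borel V) A
          = emeasure (distr (density M r) borel V) A"
        using H.integral_indicator_mult_real_cond_exp(2)[OF S Tint] int1 r0
        by (simp add: em r_def)
    qed simp
    then have "integral\<^sup>L (distr (density M (indicat_real S)) borel V) h
        = integral\<^sup>L (distr (density M r) borel V) h" by simp
    then have "(\<integral>x. indicator S x * h (V x) \<partial>M) = (\<integral>x. r x * h (V x) \<partial>M)"
      using r0 by (simp add: integral_distr integral_density)
    also have "\<dots> = (\<integral>x. indicator S x * real_cond_exp M H (\<lambda>x. h (V x)) x \<partial>M)"
      unfolding r_def by (rule H.integral_indicator_mult_real_cond_exp(1)[OF S int])
    finally show ?thesis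
      by (simp add: set_lebesgue_integral_def)
  qed
  \<comment> \<open>The identity over all \<open>S\<close> in \<open>G\<close> characterizes
    conditioning on \<open>G\<close>. The version given \<open>H\<close> is an admissible candidate
    because \<open>HG\<close> makes it \<open>G\<close>-measurable.\<close>
  then show ?thesis
    using int H.real_cond_exp_int(1)[OF int]
    by (intro G.real_cond_exp_charact measurable_from_subalg[OF HG]) auto
qed

section \<open>Conditional independence and enlarging the conditioning vector\<close>

text \<open>By second countability the Borel sets of the product are generated by measurable
  rectangles, and taking preimages commutes with generating a \<sigma>-algebra. This supplies the
  \<pi>-system on which conditional independence can be tested.\<close>

lemma sets_sigma_of_Pair:
  fixes W :: "'a \<Rightarrow> 'w::second_countable_topology" and Z :: "'a \<Rightarrow> 'z::second_countable_topology"
  shows "sets (sigma_of M (\<lambda>x. (W x, Z x))) = sigma_sets (space M)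
    {{x \<in> space M. W x \<in> B \<and> Z x \<in> E} | B E. B \<in> sets borel \<and> E \<in> sets borel}"
proof -
  let ?f = "\<lambda>x. (W x, Z x)"
  have "sets (sigma_of M ?f) = {?f -` A \<inter> space M | A. A \<in> sets (borel \<Otimes>\<^sub>M borel)}"
    unfolding borel_prod by (simp add: sigma_of_def sets_vimage_algebra2)
  also have "\<dots> = sigma_sets (space M)
      {?f -` A \<inter> space M | A. A \<in> {B \<times> E | B E. B \<in> sets borel \<and> E \<in> sets borel}}"
    unfolding sets_pair_measure by (intro sigma_sets_vimage_commute) auto
  also have "{?f -` A \<inter> space M | A. A \<in> {B \<times> E | B E. B \<in> sets borel \<and> E \<in> sets borel}}
      = {{x \<in> space M. W x \<in> B \<and> Z x \<in> E} | B E. B \<in> sets borel \<and> E \<in> sets borel}"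
  proof -
    have rect: "?f -` (B \<times> E) \<inter> space M = {x \<in> space M. W x \<in> B \<and> Z x \<in> E}" for B E by auto
    show ?thesis
    proof (intro set_eqI iffI)
      fix R assume "R \<in> {?f -` A \<inter> space M | A. A \<in> {B \<times> E | B E. B \<in> sets borel \<and> E \<in> sets borel}}"
      then obtain B E where "R = ?f -` (B \<times> E) \<inter> space M" "B \<in> sets borel" "E \<in> sets borel"
        by auto
      then show "R \<in> {{x \<in> space M. W x \<in> B \<and> Z x \<in> E} | B E. B \<in> sets borel \<and> E \<in> sets borel}"
        unfolding rect by auto
    next
      fix R assume "R \<in> {{x \<in> space M. W x \<in> B \<and> Z x \<in> E} | B E. B \<in> sets borel \<and> E \<in> sets borel}"
      then obtain B E where "R = ?f -` (B \<times> E) \<inter> space M" "B \<in> sets borel" "E \<in> sets borel"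
        unfolding rect by auto
      then show "R \<in> {?f -` A \<inter> space M | A. A \<in> {B \<times> E | B E. B \<in> sets borel \<and> E \<in> sets borel}}"
        by auto
    qed
  qed
  finally show ?thesis .
qed

lemma sets_sigma_of:
  "sets (sigma_of M Z) = {{x \<in> space M. Z x \<in> E} | E. E \<in> sets borel}"
proof -
  have "Z -` E \<inter> space M = {x \<in> space M. Z x \<in> E}" for E by blast
  then show ?thesis
    unfolding sigma_of_def by (simp add: sets_vimage_algebra2)
qed

lemma subalgebra_sigma_of_Pair:
  fixes W :: "'a \<Rightarrow> 'w::second_countable_topology" and Z :: "'a \<Rightarrow> 'z::second_countable_topology"
  shows "subalgebra (sigma_of M (\<lambda>x. (W x, Z x))) (sigma_of M Z)"
proof -
  have "{{x \<in> space M. Z x \<in> E} | E. E \<in> sets borel}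
      \<subseteq> {{x \<in> space M. W x \<in> B \<and> Z x \<in> E} | B E. B \<in> sets borel \<and> E \<in> sets borel}"
  proof safe
    fix E :: "'z set" assume "E \<in> sets borel"
    then show "\<exists>B E'. {x \<in> space M. Z x \<in> E} = {x \<in> space M. W x \<in> B \<and> Z x \<in> E'}
        \<and> B \<in> sets borel \<and> E' \<in> sets borel"
      by (intro exI[of _ UNIV] exI[of _ E]) simp
  qed
  then show ?thesis
    unfolding subalgebra_def sets_sigma_of_Pair sets_sigma_of
    by (auto simp: sigma_of_def intro!: sigma_sets.Basic)
qed

text \<open>On a rectangle, the event on \<open>Z\<close> can be absorbed when conditioning on
  \<open>Z\<close>, while the event on \<open>W\<close> splits off by the product formula. So the
  conditional probability given \<open>Z\<close> already has the right integrals over rectangles,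
  hence over all sets generated by \<open>(W, Z)\<close>.\<close>

lemma (in prob_space) cond_indep_cprob_eq:
  fixes V :: "'a \<Rightarrow> 'v::topological_space"
    and W :: "'a \<Rightarrow> 'w::second_countable_topology" and Z :: "'a \<Rightarrow> 'z::second_countable_topology"
  assumes [measurable]: "V \<in> borel_measurable M" "W \<in> borel_measurable M" "Z \<in> borel_measurable M"
    and ci: "cond_indep M V W Z" and A[measurable]: "A \<in> sets borel"
  shows "AE x in M. cprob M (\<lambda>x. (W x, Z x)) (\<lambda>x. V x \<in> A) x = cprob M Z (\<lambda>x. V x \<in> A) x"
proof -
  let ?WZ = "\<lambda>x. (W x, Z x)"
  interpret G: finite_measure_subalgebra M "sigma_of M ?WZ"
    by (rule finite_measure_subalgebra_sigma_of) measurable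
  interpret H: finite_measure_subalgebra M "sigma_of M Z"
    by (rule finite_measure_subalgebra_sigma_of) measurable
  define T where "T = {x \<in> space M. V x \<in> A}"
  have T[measurable]: "T \<in> sets M" by (simp add: T_def)
  define t where "t = real_cond_exp M (sigma_of M Z) (indicator T)"
  have t[measurable]: "t \<in> borel_measurable (sigma_of M Z)" and tint: "integrable M t"
    and Tint: "integrable M (indicat_real T)"
    using H.integrable_real_cond_exp_indicator[OF T] by (auto simp: t_def)
  let ?Gen = "{{x \<in> space M. W x \<in> B \<and> Z x \<in> E} | B E. B \<in> sets borel \<and> E \<in> sets borel}"
  have rect: "(\<integral>x\<in>R. indicator T x \<partial>M) = (\<integral>x\<in>R. t x \<partial>M)" if R: "R \<in> ?Gen" for R
  proof -
    obtain B E where B[measurable]: "B \<in> sets borel" and E[measurable]: "E \<in> sets borel"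
      and R_eq: "R = {x \<in> space M. W x \<in> B \<and> Z x \<in> E}"
      using R by blast
    define b where "b = {x \<in> space M. W x \<in> B}"
    define e where "e = {x \<in> space M. Z x \<in> E}"
    have b[measurable]: "b \<in> sets M" by (simp add: b_def)
    have e[measurable]: "e \<in> sets (sigma_of M Z)"
      unfolding e_def sets_sigma_of using E by blast
    have eM[measurable]: "e \<in> sets M" by (simp add: e_def)
    have Tb: "T \<inter> b = {x \<in> space M. V x \<in> A \<and> W x \<in> B}" by (auto simp: T_def b_def)
    have Tbint: "integrable M (indicat_real (T \<inter> b))"
      by (rule H.integrable_real_cond_exp_indicator) simp
    have prod: "AE x in M. real_cond_exp M (sigma_of M Z) (indicator (T \<inter> b)) x
        = t x * real_cond_exp M (sigma_of M Z) (indicator b) x"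
      using ci A B unfolding cond_indep_def cprob_def cexp_def t_def Tb by (simp add: T_def b_def)
    \<comment> \<open>The factor \<open>1_e * t\<close> is measurable with respect to
      \<open>Z\<close>. Integrability of the product with \<open>1_b\<close> lets
      \<open>real_cond_exp_intg\<close> undo the conditioning of \<open>1_b\<close> below.\<close>
    have etb: "integrable M (\<lambda>x. indicator e x * t x * indicat_real b x)"
      using integrable_mult_indicator[OF sets.Int[OF eM b] tint]
      by (simp add: indicator_inter_arith mult_ac)
    have "(\<integral>x\<in>R. indicator T x \<partial>M) = (\<integral>x\<in>e. indicator (T \<inter> b) x \<partial>M)"
      unfolding set_lebesgue_integral_def R_eq
      by (intro Bochner_Integration.integral_cong) (auto simp: indicator_def e_def b_def)
    also have "\<dots> = (\<integral>x\<in>e. real_cond_exp M (sigma_of M Z) (indicator (T \<inter> b)) x \<partial>M)"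
      by (rule H.real_cond_exp_intA[OF Tbint e])
    also have "\<dots> = (\<integral>x. indicator e x * t x * real_cond_exp M (sigma_of M Z) (indicator b) x \<partial>M)"
      unfolding set_lebesgue_integral_def using prod measurable_from_subalg[OF H.subalg t]
      by (intro integral_cong_AE) (auto elim!: eventually_mono)
    also have "\<dots> = (\<integral>x. indicator e x * t x * indicator b x \<partial>M)"
      by (rule H.real_cond_exp_intg(2)[OF etb]) auto
    also have "\<dots> = (\<integral>x\<in>R. t x \<partial>M)"
      unfolding set_lebesgue_integral_def R_eq
      by (intro Bochner_Integration.integral_cong) (auto simp: indicator_def e_def b_def)
    finally show ?thesis .
  qed
  have stable: "Int_stable ?Gen"
  proof (rule Int_stableI)
    fix a b assume "a \<in> ?Gen" "b \<in> ?Gen"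
    then obtain B E B' E' where "B \<in> sets borel" "E \<in> sets borel" "B' \<in> sets borel" "E' \<in> sets borel"
      "a = {x \<in> space M. W x \<in> B \<and> Z x \<in> E}" "b = {x \<in> space M. W x \<in> B' \<and> Z x \<in> E'}" by blast
    then show "a \<inter> b \<in> ?Gen"
      by (intro CollectI exI[of _ "B \<inter> B'"] exI[of _ "E \<inter> E'"]) auto
  qed
  have "?Gen \<subseteq> sets M" by auto
  moreover have "(\<integral>x. indicator T x \<partial>M) = (\<integral>x. t x \<partial>M)"
    using H.real_cond_exp_int(2)[OF Tint] by (simp add: t_def)
  ultimately have "(\<integral>x\<in>S. indicator T x \<partial>M) = (\<integral>x\<in>S. t x \<partial>M)" if "S \<in> sets (sigma_of M ?WZ)" for S
    using set_integral_eq_on_sigma_sets[OF Tint tint stable _ _ rect] that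
    unfolding sets_sigma_of_Pair by blast
  then have "AE x in M. real_cond_exp M (sigma_of M ?WZ) (indicator T) x = t x"
    using Tint tint measurable_from_subalg[OF subalgebra_sigma_of_Pair t]
    by (intro G.real_cond_exp_charact) auto
  then show ?thesis
    by (simp add: cprob_def cexp_def t_def T_def)
qed

text \<open>Passes from events to functions of \<open>V\<close>. With \<open>V\<close> the pair of
  outcomes and \<open>h\<close> a coordinate or its square, it compares the conditional first and
  second moments.\<close>

lemma (in prob_space) cond_indep_cexp_eq:
  fixes V :: "'a \<Rightarrow> 'v::topological_space" and h :: "'v \<Rightarrow> real"
    and W :: "'a \<Rightarrow> 'w::second_countable_topology" and Z :: "'a \<Rightarrow> 'z::second_countable_topology"
  assumes [measurable]: "V \<in> borel_measurable M" "W \<in> borel_measurable M" "Z \<in> borel_measurable M"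
    and ci: "cond_indep M V W Z"
    and "h \<in> borel_measurable borel" "integrable M (\<lambda>x. h (V x))"
  shows "AE x in M. cexp M (\<lambda>x. (W x, Z x)) (\<lambda>x. h (V x)) x = cexp M Z (\<lambda>x. h (V x)) x"
  unfolding cexp_def
proof (rule real_cond_exp_eq_of_indicators[OF _ _ subalgebra_sigma_of_Pair, where V=V and h=h])
  show "subalgebra M (sigma_of M (\<lambda>x. (W x, Z x)))" "subalgebra M (sigma_of M Z)"
    by (intro finite_measure_subalgebra.subalg finite_measure_subalgebra_sigma_of; measurable)+
  show "AE x in M. real_cond_exp M (sigma_of M (\<lambda>x. (W x, Z x))) (indicator {x \<in> space M. V x \<in> A}) x
      = real_cond_exp M (sigma_of M Z) (indicator {x \<in> space M. V x \<in> A}) x"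
    if "A \<in> sets borel" for A
    using cond_indep_cprob_eq[OF assms(1-4) that] by (simp add: cprob_def cexp_def)
qed (use assms in auto)

section \<open>Conditional variance through moments\<close>

text \<open>The squared deviation inside \<open>cvar\<close> depends on \<open>Z\<close> through its
  centering, so it is not a fixed function of the outcomes. The moment form involves only such
  functions and is therefore within reach of \<open>cond_indep_cexp_eq\<close>.\<close>

lemma (in prob_space) cvar_eq:
  assumes Z: "Z \<in> borel_measurable M"
    and Y[measurable]: "Y \<in> borel_measurable M" and Y2: "integrable M (\<lambda>x. (Y x)\<^sup>2)"
  shows "AE x in M. cvar M Z Y x = cexp M Z (\<lambda>x. (Y x)\<^sup>2) x - (cexp M Z Y x)\<^sup>2"
proof -
  interpret H: finite_measure_subalgebra M "sigma_of M Z"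
    by (rule finite_measure_subalgebra_sigma_of[OF Z])
  let ?E = "real_cond_exp M (sigma_of M Z)"
  have Y1: "integrable M Y"
    by (rule square_integrable_imp_integrable[OF Y Y2])
  \<comment> \<open>Conditional Jensen for the square.\<close>
  have m2: "integrable M (\<lambda>x. (?E Y x)\<^sup>2)"
    by (rule H.integrable_convex_cond_exp[OF Y1, where I=UNIV])
       (use Y2 in \<open>auto simp: convex_power2 emeasure_eq_measure\<close>)
  have [measurable]: "?E Y \<in> borel_measurable M" by simp
  have mY: "integrable M (\<lambda>x. ?E Y x * Y x)"
  proof (rule Bochner_Integration.integrable_bound)
    show "integrable M (\<lambda>x. (?E Y x)\<^sup>2 + (Y x)\<^sup>2)" using m2 Y2 by simp
    have "\<bar>a * b\<bar> \<le> a\<^sup>2 + b\<^sup>2" for a b :: real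
      using sum_squares_bound[of "\<bar>a\<bar>" "\<bar>b\<bar>"] mult_nonneg_nonneg[of "\<bar>a\<bar>" "\<bar>b\<bar>"]
      unfolding abs_mult power2_abs by linarith
    then show "AE x in M. norm (?E Y x * Y x) \<le> norm ((?E Y x)\<^sup>2 + (Y x)\<^sup>2)" by simp
  qed measurable
  \<comment> \<open>In the cross term \<open>?E Y\<close> is measurable with respect to
    \<open>Z\<close> and pulls out, leaving \<open>-2 * (?E Y)^2\<close>; together with the last
    square this gives \<open>-(?E Y)^2\<close>.\<close>
  have expand: "(\<lambda>x. (Y x - ?E Y x)\<^sup>2) = (\<lambda>x. ((Y x)\<^sup>2 - 2 * (?E Y x * Y x)) + (?E Y x)\<^sup>2)"
    by (auto simp: power2_eq_square algebra_simps)
  have "AE x in M. ?E (\<lambda>x. ((Y x)\<^sup>2 - 2 * (?E Y x * Y x)) + (?E Y x)\<^sup>2) x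
      = ?E (\<lambda>x. (Y x)\<^sup>2 - 2 * (?E Y x * Y x)) x + ?E (\<lambda>x. (?E Y x)\<^sup>2) x"
    using Y2 m2 mY by (intro H.real_cond_exp_add) auto
  moreover have "AE x in M. ?E (\<lambda>x. (Y x)\<^sup>2 - 2 * (?E Y x * Y x)) x
      = ?E (\<lambda>x. (Y x)\<^sup>2) x - ?E (\<lambda>x. 2 * (?E Y x * Y x)) x"
    using Y2 mY by (intro H.real_cond_exp_diff) auto
  moreover have "AE x in M. ?E (\<lambda>x. 2 * (?E Y x * Y x)) x = 2 * ?E (\<lambda>x. ?E Y x * Y x) x"
    using mY by (rule H.real_cond_exp_cmult)
  moreover have "AE x in M. ?E (\<lambda>x. ?E Y x * Y x) x = ?E Y x * ?E Y x"
    using mY by (intro H.real_cond_exp_mult) auto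
  moreover have "AE x in M. ?E (\<lambda>x. (?E Y x)\<^sup>2) x = (?E Y x)\<^sup>2"
    using m2 by (intro H.real_cond_exp_F_meas) auto
  ultimately show ?thesis
    unfolding cvar_def cexp_def expand
    by eventually_elim (simp add: power2_eq_square)
qed

section \<open>Conditional Jensen inequality for the reciprocal\<close>

text \<open>A bridge for the Jensen argument, where the integrable \<open>f\<close> is conditioned
  as a real function but its reciprocal only in [0,\<infinity>]. Both versions have the same
  integrals over the sets of \<open>F\<close>.\<close>

lemma (in finite_measure_subalgebra) nn_cond_exp_ennreal:
  assumes f: "integrable M f" and nn: "AE x in M. 0 \<le> f x"
  shows "AE x in M. ennreal (real_cond_exp M F f x) = nn_cond_exp M F (\<lambda>x. ennreal (f x)) x"
proof (rule nn_cond_exp_charact)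
  fix A assume A: "A \<in> sets F"
  then have AM: "A \<in> sets M" using subalg by (auto simp: subalgebra_def)
  have *: "(\<integral>\<^sup>+x\<in>A. ennreal (g x) \<partial>M) = ennreal (\<integral>x\<in>A. g x \<partial>M)"
    if g: "integrable M g" "AE x in M. 0 \<le> g x" for g
  proof -
    have "(\<integral>\<^sup>+x\<in>A. ennreal (g x) \<partial>M) = (\<integral>\<^sup>+x. ennreal (indicator A x *\<^sub>R g x) \<partial>M)"
      by (intro nn_integral_cong) (auto simp: indicator_def)
    also have "\<dots> = ennreal (\<integral>x\<in>A. g x \<partial>M)"
      unfolding set_lebesgue_integral_def
      using g integrable_mult_indicator[OF AM g(1)]
      by (intro nn_integral_eq_integral) (auto simp: indicator_def)
    finally show ?thesis .
  qed
  show "(\<integral>\<^sup>+x\<in>A. ennreal (f x) \<partial>M) = (\<integral>\<^sup>+x\<in>A. ennreal (real_cond_exp M F f x) \<partial>M)"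
    using real_cond_exp_intA[OF f A] real_cond_exp_int(1)[OF f]
      real_cond_exp_pos[OF nn borel_measurable_integrable[OF f]] f nn by (simp add: *)
qed (use f in auto)

text \<open>
  As \<open>1/f\<close> may fail to be integrable, Jensen's inequality is replaced by the tangent line of \<open>1/x\<close> at
  \<open>E[f | F]\<close>.
\<close>

lemma (in finite_measure_subalgebra) inverse_real_cond_exp_le:
  assumes f: "integrable M f" and pos: "AE x in M. 0 < f x"
  shows "AE x in M. inverse (ennreal (real_cond_exp M F f x))
    \<le> nn_cond_exp M F (\<lambda>x. inverse (ennreal (f x))) x"
proof -
  let ?q = "real_cond_exp M F f" and ?N = "nn_cond_exp M F"
  have [measurable]: "f \<in> borel_measurable M" using f by simp
  have [measurable]: "?q \<in> borel_measurable M" by simp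
  have q: "AE x in M. 0 < ?q x"
    by (rule real_cond_exp_gr_c[OF f pos])
  define w where "w = (\<lambda>x. ennreal (1 / (?q x)\<^sup>2))"
  have w[measurable]: "w \<in> borel_measurable F" by (simp add: w_def)
  have wM[measurable]: "w \<in> borel_measurable M" by (rule measurable_from_subalg[OF subalg w])
  have v[measurable]: "(\<lambda>x. ennreal (2 / ?q x)) \<in> borel_measurable F" by simp
  \<comment> \<open>The tangent to \<open>1/x\<close> at \<open>q\<close> gives
    \<open>1/f >= 2/q - f/q^2\<close>. The negative term is moved to the other side, so that every
    term lives in \<open>ennreal\<close>; the gap is \<open>(f - q)^2 / (f * q^2)\<close>.\<close>
  have tangent: "AE x in M. ennreal (2 / ?q x) \<le> inverse (ennreal (f x)) + w x * ennreal (f x)"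
    using pos q
  proof eventually_elim
    case (elim x)
    have "0 \<le> (f x - ?q x)\<^sup>2 / (f x * (?q x)\<^sup>2)"
      using elim by simp
    also have "\<dots> = 1 / f x + 1 / (?q x)\<^sup>2 * f x - 2 / ?q x"
      using elim by (simp add: field_simps power2_eq_square)
    finally have "2 / ?q x \<le> 1 / f x + 1 / (?q x)\<^sup>2 * f x" by simp
    with elim show ?case
      by (simp add: w_def inverse_ennreal inverse_eq_divide ennreal_mult[symmetric]
          ennreal_plus[symmetric] ennreal_leI del: ennreal_plus)
  qed
  have "AE x in M. ennreal (2 / ?q x) = ?N (\<lambda>x. ennreal (2 / ?q x)) x"
    by (rule nn_cond_exp_F_meas[OF v])
  moreover have "AE x in M. ?N (\<lambda>x. ennreal (2 / ?q x)) x
      \<le> ?N (\<lambda>x. inverse (ennreal (f x)) + w x * ennreal (f x)) x"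
    using tangent by (rule nn_cond_exp_mono) simp_all
  moreover have "AE x in M. ?N (\<lambda>x. inverse (ennreal (f x))) x + ?N (\<lambda>x. w x * ennreal (f x)) x
      = ?N (\<lambda>x. inverse (ennreal (f x)) + w x * ennreal (f x)) x"
    by (rule nn_cond_exp_sum) simp_all
  moreover have "AE x in M. w x * ?N (\<lambda>x. ennreal (f x)) x = ?N (\<lambda>x. w x * ennreal (f x)) x"
    by (rule nn_cond_exp_prod) simp_all
  moreover have "AE x in M. ennreal (?q x) = ?N (\<lambda>x. ennreal (f x)) x"
    using pos by (intro nn_cond_exp_ennreal[OF f]) (auto elim: eventually_mono)
  ultimately show ?thesis
    using q
  proof eventually_elim
    case (elim x)
    \<comment> \<open>Conditioning turns \<open>f/q^2\<close> into \<open>1/q\<close>. As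
      \<open>q > 0\<close>, this is finite and cancels against one half of
      \<open>2/q\<close>.\<close>
    have "w x * ennreal (?q x) = ennreal (1 / ?q x)"
      using elim(6) by (simp add: w_def ennreal_mult[symmetric] power2_eq_square)
    then have "ennreal (2 / ?q x) \<le> ?N (\<lambda>x. inverse (ennreal (f x))) x + ennreal (1 / ?q x)"
      using elim by simp
    moreover have "ennreal (2 / ?q x) = ennreal (1 / ?q x) + ennreal (1 / ?q x)"
      using elim(6) by (simp add: ennreal_plus[symmetric] del: ennreal_plus)
    ultimately show ?case
      using elim(6)
      by (simp add: inverse_ennreal inverse_eq_divide add.commute[of "?N _ x"]
          ennreal_add_left_cancel_le)
  qed
qed

text \<open>An \<open>F\<close>-measurable weight preserves the pointwise Jensen inequality, and
  after integration it lets the conditioning on the reciprocal be removed. Both sides may be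
  infinite.\<close>

lemma (in finite_measure_subalgebra) nn_integral_divide_real_cond_exp_le:
  assumes f: "integrable M f" and pos: "AE x in M. 0 < f x"
    and s[measurable]: "s \<in> borel_measurable F"
  shows "(\<integral>\<^sup>+x. s x / ennreal (real_cond_exp M F f x) \<partial>M) \<le> (\<integral>\<^sup>+x. s x / ennreal (f x) \<partial>M)"
proof -
  have [measurable]: "f \<in> borel_measurable M" using f by simp
  have "(\<integral>\<^sup>+x. s x / ennreal (real_cond_exp M F f x) \<partial>M)
      \<le> (\<integral>\<^sup>+x. s x * nn_cond_exp M F (\<lambda>x. inverse (ennreal (f x))) x \<partial>M)"
    using inverse_real_cond_exp_le[OF f pos]
    by (intro nn_integral_mono_AE) (auto simp: divide_ennreal_def intro: mult_left_mono elim!: eventually_mono)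
  also have "\<dots> = (\<integral>\<^sup>+x. s x / ennreal (f x) \<partial>M)"
    unfolding divide_ennreal_def by (intro nn_cond_exp_intg) simp_all
  finally show ?thesis .
qed

theorem theorem5:
  fixes M :: "'a measure"
    and YT YC D :: "'a \<Rightarrow> real"
    and I :: "'a \<Rightarrow> 'i::euclidean_space"
    and U :: "'a \<Rightarrow> 'u::euclidean_space"
    and C :: "'a \<Rightarrow> 'c::euclidean_space"
  defines "X \<equiv> (\<lambda>\<omega>. (I \<omega>, U \<omega>, C \<omega>))"
    and "X1 \<equiv> (\<lambda>\<omega>. (U \<omega>, C \<omega>))"
  assumes "prob_space M"
    and "YT \<in> borel_measurable M" and "integrable M (\<lambda>\<omega>. (YT \<omega>)\<^sup>2)"
    and "YC \<in> borel_measurable M" and "integrable M (\<lambda>\<omega>. (YC \<omega>)\<^sup>2)"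
    and "D \<in> borel_measurable M" and "\<And>\<omega>. \<omega> \<in> space M \<Longrightarrow> D \<omega> \<in> {0, 1}"
    and "I \<in> borel_measurable M" and "U \<in> borel_measurable M" and "C \<in> borel_measurable M"
    and unconfoundedness: "cond_indep M (\<lambda>\<omega>. (YT \<omega>, YC \<omega>)) D X"
    and overlap: "AE \<omega> in M. 0 < propensity M D X \<omega> \<and> propensity M D X \<omega> < 1"
    and exclusion: "cond_indep M (\<lambda>\<omega>. (YT \<omega>, YC \<omega>)) I X1"
  shows "efficiency_bound M YT YC D X1 \<le> efficiency_bound M YT YC D X"
proof -
  interpret prob_space M by fact
  let ?V = "\<lambda>\<omega>. (YT \<omega>, YC \<omega>)"
  have [measurable]: "YT \<in> borel_measurable M" "YC \<in> borel_measurable M" "D \<in> borel_measurable M"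
    "I \<in> borel_measurable M" "U \<in> borel_measurable M" "C \<in> borel_measurable M"
    by fact+
  have X1[measurable]: "X1 \<in> borel_measurable M" and X[measurable]: "X \<in> borel_measurable M"
    unfolding X1_def X_def by measurable
  \<comment> \<open>Tuples nest to the right, so \<open>X\<close> is literally the pair of
    \<open>I\<close> and \<open>X1\<close>, the shape of \<open>(W, Z)\<close> in the lemmas on
    conditional independence.\<close>
  have X_eq: "X = (\<lambda>\<omega>. (I \<omega>, X1 \<omega>))" by (simp add: X_def X1_def)
  interpret G: finite_measure_subalgebra M "sigma_of M X"
    by (rule finite_measure_subalgebra_sigma_of[OF X])
  interpret H: finite_measure_subalgebra M "sigma_of M X1"
    by (rule finite_measure_subalgebra_sigma_of[OF X1])

  \<comment> \<open>Equality of conditional means and variances\<close>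
  have cexp_eq: "AE \<omega> in M. cexp M X (\<lambda>\<omega>. h (?V \<omega>)) \<omega> = cexp M X1 (\<lambda>\<omega>. h (?V \<omega>)) \<omega>"
    if "h \<in> borel_measurable borel" "integrable M (\<lambda>\<omega>. h (?V \<omega>))" for h :: "real \<times> real \<Rightarrow> real"
    unfolding X_eq using that by (intro cond_indep_cexp_eq exclusion) measurable
  have T2: "integrable M (\<lambda>\<omega>. (YT \<omega>)\<^sup>2)" and C2: "integrable M (\<lambda>\<omega>. (YC \<omega>)\<^sup>2)"
    by fact+
  have T1: "integrable M YT" and C1: "integrable M YC"
    using T2 C2 by (auto intro: square_integrable_imp_integrable)
  have fst_borel[measurable]: "fst \<in> borel_measurable (borel :: (real \<times> real) measure)"
    and snd_borel[measurable]: "snd \<in> borel_measurable (borel :: (real \<times> real) measure)"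
    by (intro borel_measurable_continuous_onI continuous_intros)+
  have mT: "AE \<omega> in M. cexp M X YT \<omega> = cexp M X1 YT \<omega>"
    using cexp_eq[OF fst_borel] T1 by simp
  have mC: "AE \<omega> in M. cexp M X YC \<omega> = cexp M X1 YC \<omega>"
    using cexp_eq[OF snd_borel] C1 by simp
  have "AE \<omega> in M. cexp M X (\<lambda>\<omega>. (YT \<omega>)\<^sup>2) \<omega> = cexp M X1 (\<lambda>\<omega>. (YT \<omega>)\<^sup>2) \<omega>"
    using cexp_eq[OF borel_measurable_power[OF fst_borel]] T2 by simp
  moreover have "AE \<omega> in M. cvar M X YT \<omega> = cexp M X (\<lambda>\<omega>. (YT \<omega>)\<^sup>2) \<omega> - (cexp M X YT \<omega>)\<^sup>2"
    "AE \<omega> in M. cvar M X1 YT \<omega> = cexp M X1 (\<lambda>\<omega>. (YT \<omega>)\<^sup>2) \<omega> - (cexp M X1 YT \<omega>)\<^sup>2"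
    using T2 by (intro cvar_eq X X1; measurable)+
  ultimately have vT: "AE \<omega> in M. cvar M X YT \<omega> = cvar M X1 YT \<omega>"
    using mT by eventually_elim simp
  have "AE \<omega> in M. cexp M X (\<lambda>\<omega>. (YC \<omega>)\<^sup>2) \<omega> = cexp M X1 (\<lambda>\<omega>. (YC \<omega>)\<^sup>2) \<omega>"
    using cexp_eq[OF borel_measurable_power[OF snd_borel]] C2 by simp
  moreover have "AE \<omega> in M. cvar M X YC \<omega> = cexp M X (\<lambda>\<omega>. (YC \<omega>)\<^sup>2) \<omega> - (cexp M X YC \<omega>)\<^sup>2"
    "AE \<omega> in M. cvar M X1 YC \<omega> = cexp M X1 (\<lambda>\<omega>. (YC \<omega>)\<^sup>2) \<omega> - (cexp M X1 YC \<omega>)\<^sup>2"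
    using C2 by (intro cvar_eq X X1; measurable)+
  ultimately have vC: "AE \<omega> in M. cvar M X YC \<omega> = cvar M X1 YC \<omega>"
    using mC by eventually_elim simp

  \<comment> \<open>Propensities and the tower property\<close>
  define T where "T = {\<omega> \<in> space M. D \<omega> = 1}"
  have Tm[measurable]: "T \<in> sets M" by (simp add: T_def)
  define p where "p = propensity M D X"
  define p1 where "p1 = propensity M D X1"
  have p_eq: "p = real_cond_exp M (sigma_of M X) (indicator T)"
    and p1_eq: "p1 = real_cond_exp M (sigma_of M X1) (indicator T)"
    by (simp_all add: p_def p1_def propensity_def cprob_def cexp_def T_def)
  have p: "integrable M p" and Tint: "integrable M (indicat_real T)"
    using G.integrable_real_cond_exp_indicator[OF Tm] by (simp_all add: p_eq)
  have [measurable]: "p \<in> borel_measurable M" using p by simp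
  have [measurable]: "p1 \<in> borel_measurable M" by (simp add: p1_eq)
  have tower: "AE \<omega> in M. real_cond_exp M (sigma_of M X1) p \<omega> = p1 \<omega>"
    unfolding p_eq p1_eq using subalgebra_sigma_of_Pair[of M I X1] Tint
    by (intro H.real_cond_exp_nested_subalg G.subalg) (simp_all add: X_eq)
  \<comment> \<open>The control arm has the same structure with \<open>1 - p\<close> in place of
    \<open>p\<close>, so the reciprocal inequality can be reused.\<close>
  have tower': "AE \<omega> in M. real_cond_exp M (sigma_of M X1) (\<lambda>\<omega>. 1 - p \<omega>) \<omega> = 1 - p1 \<omega>"
  proof -
    have "AE \<omega> in M. real_cond_exp M (sigma_of M X1) (\<lambda>\<omega>. 1 - p \<omega>) \<omega>
        = real_cond_exp M (sigma_of M X1) (\<lambda>_. 1) \<omega> - real_cond_exp M (sigma_of M X1) p \<omega>"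
      using p by (intro H.real_cond_exp_diff) auto
    moreover have "AE \<omega> in M. real_cond_exp M (sigma_of M X1) (\<lambda>_. 1) \<omega> = 1"
      by (intro H.real_cond_exp_F_meas) auto
    ultimately show ?thesis
      using tower by eventually_elim simp
  qed
  let ?s = "\<lambda>Y \<omega>. ennreal (cvar M X1 Y \<omega>)"
  have sH[measurable]: "?s Y \<in> borel_measurable (sigma_of M X1)" for Y
    by (simp add: cvar_def cexp_def)
  have [measurable]: "cvar M X1 Y \<in> borel_measurable M" for Y
    by (simp add: cvar_def cexp_def)
  let ?b = "\<lambda>\<omega>. ennreal ((cate M YT YC X1 \<omega> - ate M YT YC)\<^sup>2)"
  have "cexp M X1 Y \<in> borel_measurable M" for Y
    by (simp add: cexp_def)
  then have [measurable]: "cate M YT YC X1 \<in> borel_measurable M"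
    unfolding cate_def by (intro borel_measurable_diff)
  have overlap: "AE \<omega> in M. 0 < p \<omega>" "AE \<omega> in M. 0 < 1 - p \<omega>"
    using overlap by (auto simp: p_def elim: eventually_mono)

  \<comment> \<open>Comparison of the two bounds, term by term\<close>
  have "(\<integral>\<^sup>+\<omega>. ?s YT \<omega> / ennreal (p1 \<omega>) \<partial>M)
      = (\<integral>\<^sup>+\<omega>. ?s YT \<omega> / ennreal (real_cond_exp M (sigma_of M X1) p \<omega>) \<partial>M)"
    using tower by (intro nn_integral_cong_AE) (auto elim: eventually_mono)
  also have "\<dots> \<le> (\<integral>\<^sup>+\<omega>. ?s YT \<omega> / ennreal (p \<omega>) \<partial>M)"
    using p overlap by (intro H.nn_integral_divide_real_cond_exp_le) auto
  finally have leT: "(\<integral>\<^sup>+\<omega>. ?s YT \<omega> / ennreal (p1 \<omega>) \<partial>M) \<le> (\<integral>\<^sup>+\<omega>. ?s YT \<omega> / ennreal (p \<omega>) \<partial>M)" .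
  have "(\<integral>\<^sup>+\<omega>. ?s YC \<omega> / ennreal (1 - p1 \<omega>) \<partial>M)
      = (\<integral>\<^sup>+\<omega>. ?s YC \<omega> / ennreal (real_cond_exp M (sigma_of M X1) (\<lambda>\<omega>. 1 - p \<omega>) \<omega>) \<partial>M)"
    using tower' by (intro nn_integral_cong_AE) (auto elim: eventually_mono)
  also have "\<dots> \<le> (\<integral>\<^sup>+\<omega>. ?s YC \<omega> / ennreal (1 - p \<omega>) \<partial>M)"
    using p overlap by (intro H.nn_integral_divide_real_cond_exp_le) auto
  finally have leC: "(\<integral>\<^sup>+\<omega>. ?s YC \<omega> / ennreal (1 - p1 \<omega>) \<partial>M)
      \<le> (\<integral>\<^sup>+\<omega>. ?s YC \<omega> / ennreal (1 - p \<omega>) \<partial>M)" .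

  have "efficiency_bound M YT YC D X1 = (\<integral>\<^sup>+\<omega>. ?s YT \<omega> / ennreal (p1 \<omega>) \<partial>M)
      + (\<integral>\<^sup>+\<omega>. ?s YC \<omega> / ennreal (1 - p1 \<omega>) \<partial>M) + (\<integral>\<^sup>+\<omega>. ?b \<omega> \<partial>M)"
    unfolding efficiency_bound_def p1_def[symmetric] by (simp add: nn_integral_add)
  also have "\<dots> \<le> (\<integral>\<^sup>+\<omega>. ?s YT \<omega> / ennreal (p \<omega>) \<partial>M)
      + (\<integral>\<^sup>+\<omega>. ?s YC \<omega> / ennreal (1 - p \<omega>) \<partial>M) + (\<integral>\<^sup>+\<omega>. ?b \<omega> \<partial>M)"
    by (intro add_mono leT leC order_refl)
  also have "\<dots> = (\<integral>\<^sup>+\<omega>. ?s YT \<omega> / ennreal (p \<omega>) + ?s YC \<omega> / ennreal (1 - p \<omega>) + ?b \<omega> \<partial>M)"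
    by (simp add: nn_integral_add)
  \<comment> \<open>The variances and the effect term still refer to \<open>X1\<close>, as
    measurability of the weights required. The almost sure equalities now exchange them for their
    versions given \<open>X\<close>.\<close>
  also have "\<dots> = efficiency_bound M YT YC D X"
    unfolding efficiency_bound_def p_def[symmetric]
    using mT mC vT vC by (intro nn_integral_cong_AE, eventually_elim) (simp add: cate_def)
  finally show ?thesis .
qed

end
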